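(* There exists a subfield $K\subseteq \mathbb{R}$ of cardinality $\mathfrak{c}$ that has the independence property in the language of rings and in which some set $D\subseteq K$ with $D\notin\mathcal{B}(\tau_K)$ is $\emptyset$-definable.
   Context: The set theory is ZFC, and $\mathfrak{c}=2^{\aleph_0}$ is the cardinality of the continuum. The language of rings is $\mathcal{L}_{\mathrm{r}}=\{+,-,\cdot,0,1\}$; the field $K$ is regarded as an $\mathcal{L}_{\mathrm{r}}$-structure in the natural way. A set $D\subseteq K$ is $\emptyset$-definable in $K$ if there is an $\mathcal{L}_{\mathrm{r}}$-formula $\psi(x)$ without parameters such that $D=\{a\in K\mid K\models\psi(a)\}$. An $\mathcal{L}_{\mathrm{r}}$-formula $\varphi(x_1,\ldots,x_n;y_1,\ldots,y_\ell)$ has the independence property over a field $K$ if for any $m\in\mathbb{N}$ (where $\mathbb{N}$ is the set of positive natural numbers) there is a set $\{\underline{a}_1,\ldots,\underline{a}_m\}\subseteq K^n$ and a set $\{\underline{b}_I\mid I\subseteq\{1,\ldots,m\}\}\subseteq K^\ell$ such that for any $J\subseteq\{1,\ldots,m\}$ we have $K\models\bigwedge_{i\in J}\varphi(\underline{a}_i;\underline{b}_J)\wedge\bigwedge_{i\in\{1,\ldots,m\}\setminus J}\neg\varphi(\underline{a}_i;\underline{b}_J)$. The field $K$ has the independence property if some $\mathcal{L}_{\mathrm{r}}$-formula has the independence property over $K$. A subset $K\subseteq\mathbb{R}$ inherits the linear ordering of $\mathbb{R}$; $\tau_K$ denotes the order topology on $K$ with respect to this ordering, and $\mathcal{B}(\tau_K)$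 denotes the Borel $\sigma$-algebra on $K$ generated by $\tau_K$. *)

theory Defs
  imports "HOL-Analysis.Analysis" "HOL-Algebra.Algebraic_Closure_Type"
begin

section \<open>First-order logic in the language of rings\<close>

datatype ring_term =
    Var nat
  | Zero
  | One
  | Plus ring_term ring_term
  | Minus ring_term ring_term
  | Times ring_term ring_term

text \<open>Named variables. Disjunction, implication and the universal quantifier are
  the usual abbreviations.\<close>

datatype ring_formula =
    Equal ring_term ring_term
  | Neg ring_formula
  | Conj ring_formula ring_formula
  | Exists nat ring_formula

primrec term_vars :: "ring_term \<Rightarrow> nat set" where
  "term_vars (Var i) = {i}"
| "term_vars Zero = {}"
| "term_vars One = {}"
| "term_vars (Plus s t) = term_vars s \<union> term_vars t"
| "term_vars (Minus s t) = term_vars s \<union> term_vars t"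
| "term_vars (Times s t) = term_vars s \<union> term_vars t"

primrec free_vars :: "ring_formula \<Rightarrow> nat set" where
  "free_vars (Equal s t) = term_vars s \<union> term_vars t"
| "free_vars (Neg \<phi>) = free_vars \<phi>"
| "free_vars (Conj \<phi> \<psi>) = free_vars \<phi> \<union> free_vars \<psi>"
| "free_vars (Exists i \<phi>) = free_vars \<phi> - {i}"

primrec term_val :: "('a, 'm) ring_scheme \<Rightarrow> (nat \<Rightarrow> 'a) \<Rightarrow> ring_term \<Rightarrow> 'a" where
  "term_val R v (Var i) = v i"
| "term_val R v Zero = \<zero>\<^bsub>R\<^esub>"
| "term_val R v One = \<one>\<^bsub>R\<^esub>"
| "term_val R v (Plus s t) = term_val R v s \<oplus>\<^bsub>R\<^esub> term_val R v t"
| "term_val R v (Minus s t) = term_val R v s \<ominus>\<^bsub>R\<^esub> term_val R v t"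
| "term_val R v (Times s t) = term_val R v s \<otimes>\<^bsub>R\<^esub> term_val R v t"

primrec satisfies :: "('a, 'm) ring_scheme \<Rightarrow> (nat \<Rightarrow> 'a) \<Rightarrow> ring_formula \<Rightarrow> bool" where
  "satisfies R v (Equal s t) \<longleftrightarrow> term_val R v s = term_val R v t"
| "satisfies R v (Neg \<phi>) \<longleftrightarrow> \<not> satisfies R v \<phi>"
| "satisfies R v (Conj \<phi> \<psi>) \<longleftrightarrow> satisfies R v \<phi> \<and> satisfies R v \<psi>"
| "satisfies R v (Exists i \<phi>) \<longleftrightarrow> (\<exists>a\<in>carrier R. satisfies R (v(i := a)) \<phi>)"

text \<open>\<open>holds_at R \<phi> [c\<^sub>0, \<dots>, c\<^sub>k]\<close> interprets variable \<open>i \<le> k\<close> as \<open>c\<^sub>i\<close>. It is only used for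
  formulas whose free variables are at most \<open>k\<close>, so the default value \<open>\<zero>\<close> given to all
  other variables is irrelevant.\<close>

definition holds_at :: "('a, 'm) ring_scheme \<Rightarrow> ring_formula \<Rightarrow> 'a list \<Rightarrow> bool" where
  "holds_at R \<phi> cs \<longleftrightarrow> satisfies R (\<lambda>i. if i < length cs then cs ! i else \<zero>\<^bsub>R\<^esub>) \<phi>"

definition empty_definable :: "('a, 'm) ring_scheme \<Rightarrow> 'a set \<Rightarrow> bool" where
  "empty_definable R D \<longleftrightarrow>
     (\<exists>\<psi>. free_vars \<psi> \<subseteq> {0} \<and> D = {a \<in> carrier R. holds_at R \<psi> [a]})"


section \<open>The independence property\<close>

definition tuples :: "('a, 'm) ring_scheme \<Rightarrow> nat \<Rightarrow> 'a list set" where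
  "tuples R n = {xs. length xs = n \<and> set xs \<subseteq> carrier R}"

text \<open>A formula \<open>\<phi>(x\<^sub>1,\<dots>,x\<^sub>n; y\<^sub>1,\<dots>,y\<^sub>l)\<close> has its free variables among \<open>0,\<dots>,n+l-1\<close>; the first
  \<open>n\<close> of these are the \<open>x\<^sub>i\<close> and the last \<open>l\<close> are the \<open>y\<^sub>j\<close>.\<close>

definition formula_has_IP :: "('a, 'm) ring_scheme \<Rightarrow> nat \<Rightarrow> nat \<Rightarrow> ring_formula \<Rightarrow> bool" where
  "formula_has_IP R n l \<phi> \<longleftrightarrow>
     (\<forall>m::nat. m \<ge> 1 \<longrightarrow>
       (\<exists>(a :: nat \<Rightarrow> 'a list) (b :: nat set \<Rightarrow> 'a list).
          (\<forall>i\<in>{1..m}. a i \<in> tuples R n) \<and>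
          (\<forall>I. I \<subseteq> {1..m} \<longrightarrow> b I \<in> tuples R l) \<and>
          (\<forall>J. J \<subseteq> {1..m} \<longrightarrow>
             (\<forall>i\<in>J. holds_at R \<phi> (a i @ b J)) \<and>
             (\<forall>i\<in>{1..m} - J. \<not> holds_at R \<phi> (a i @ b J)))))"

definition has_IP :: "('a, 'm) ring_scheme \<Rightarrow> bool" where
  "has_IP R \<longleftrightarrow> (\<exists>n l \<phi>. free_vars \<phi> \<subseteq> {..<n + l} \<and> formula_has_IP R n l \<phi>)"


section \<open>Order topology and Borel sets on a subset of a linear order\<close>

text \<open>The topology generated by the open rays of \<open>K\<close> with endpoints in \<open>K\<close> (in general not the
  subspace topology). The whole set \<open>K\<close> is added so that the underlying set is \<open>K\<close> even
  if \<open>K\<close> is a singleton.\<close>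

definition order_topology_on :: "'a::linorder set \<Rightarrow> 'a topology" where
  "order_topology_on K = topology_generated_by
     (insert K ((\<lambda>a. {x \<in> K. x < a}) ` K \<union> (\<lambda>a. {x \<in> K. a < x}) ` K))"

definition borel_sets_of :: "'a topology \<Rightarrow> 'a set set" where
  "borel_sets_of T = sigma_sets (topspace T) {U. openin T U}"


section \<open>Subfields of the real numbers\<close>

abbreviation real_field :: "real ring" where
  "real_field \<equiv> ring_of_type_algebra"

end

theory Submission
  imports Defs
begin

text \<open>Let \<open>M\<close> be a maximal subring of \<open>\<real>\<close> over which some \<open>t > 0\<close> is transcendental. By maximality every
  real is algebraic over \<open>M[t]\<close>, so \<open>M\<close> has the cardinality of the continuum. For nonnegative \<open>s \<in> M\<close> the
  elements \<open>t + s\<close> are independent modulo squares of \<open>M(t)\<close>; hence for every set \<open>A\<close> of such \<open>s\<close> a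
  maximality argument yields a field \<open>K \<supseteq> M(t)\<close> in which \<open>t + s\<close> is a square iff \<open>s \<in> A\<close>.
  The rational part of \<open>A\<close> is fixed so that the formula ``\<open>x + y\<close> is a square'' has the independence
  property. The irrational part is arbitrary and determined by the set of squares
  of \<open>K\<close>; as there are only continuum many Borel sets, for some choice the squares are not Borel.\<close>

no_notation iso_incl (infixl \<open>\<lesssim>\<close> 65)

section \<open>Cardinality\<close>

lemma lepoll_iff_card_of_ordLeq: "A \<lesssim> B \<longleftrightarrow> ordLeq3 (card_of A) (card_of B)"
  by (simp add: lepoll_def card_of_ordLeq)

lemma UN_lepoll_infinite:
  assumes "infinite B" "I \<lesssim> B" "\<And>i. i \<in> I \<Longrightarrow> A i \<lesssim> B"
  shows "(\<Union>i\<in>I. A i) \<lesssim> B"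
  using assms by (simp add: lepoll_iff_card_of_ordLeq card_of_UNION_ordLeq_infinite)

lemma Times_lepoll_infinite:
  assumes "infinite C" "A \<lesssim> C" "B \<lesssim> C"
  shows "A \<times> B \<lesssim> C"
  using assms by (simp add: lepoll_iff_card_of_ordLeq card_of_Sigma_ordLeq_infinite)

text \<open>Two sets of cardinality below an infinite \<open>C\<close> have a union of cardinality
  below \<open>C\<close>.\<close>

lemma lepoll_Un_cases:
  assumes "infinite C" "C \<lesssim> A \<union> B"
  shows "C \<lesssim> A \<or> C \<lesssim> B"
proof (rule ccontr)
  assume "\<not> ?thesis"
  then have "ordLess2 (card_of A) (card_of C)" "ordLess2 (card_of B) (card_of C)"
    by (simp_all add: lepoll_iff_card_of_ordLeq not_ordLeq_iff_ordLess[OF card_of_Well_order card_of_Well_order])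
  then have "ordLess2 (card_of (A \<union> B)) (card_of C)"
    using card_of_Un_ordLess_infinite assms(1) by blast
  with assms(2) show False
    by (simp add: lepoll_iff_card_of_ordLeq not_ordLess_ordLeq)
qed

section \<open>Polynomials and their roots over an infinite set\<close>

definition polys_over :: "'a::zero set \<Rightarrow> 'a poly set" where
  "polys_over M = {p. \<forall>i. Polynomial.coeff p i \<in> M}"

lemma polys_over_subset_Poly_lists:
  assumes "0 \<in> M"
  shows "polys_over M \<subseteq> Poly ` lists M"
proof
  fix p assume p: "p \<in> polys_over M"
  have "set (coeffs p) \<subseteq> M"
    using p by (auto simp: polys_over_def coeffs_def)
  then show "p \<in> Poly ` lists M"
    by (intro image_eqI[of _ _ "coeffs p"]) auto
qed

text \<open>Lists of length \<open>n + 1\<close> are images of pairs of a head and a list of length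
  \<open>n\<close>. So each length contributes at most \<open>A\<close>, and there are only
  countably many lengths.\<close>

lemma lists_lepoll_infinite:
  assumes "infinite A"
  shows "lists A \<lesssim> A"
proof -
  have len: "{xs \<in> lists A. length xs = n} \<lesssim> A" for n
  proof (induction n)
    case 0
    then show ?case
      using assms by (auto intro!: finite_lepoll_infinite finite_subset[of _ "{[]}"])
  next
    case (Suc n)
    have "{xs \<in> lists A. length xs = Suc n} \<subseteq> (\<lambda>(x, xs). x # xs) ` (A \<times> {xs \<in> lists A. length xs = n})"
    proof
      fix xs assume "xs \<in> {xs \<in> lists A. length xs = Suc n}"
      then show "xs \<in> (\<lambda>(x, xs). x # xs) ` (A \<times> {xs \<in> lists A. length xs = n})"
        by (cases xs) auto
    qed
    then have "{xs \<in> lists A. length xs = Suc n} \<lesssim> A \<times> {xs \<in> lists A. length xs = n}"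
      by (rule subset_image_lepoll)
    also have "\<dots> \<lesssim> A"
      using Suc assms by (intro Times_lepoll_infinite) auto
    finally show ?case .
  qed
  have "lists A = (\<Union>n. {xs \<in> lists A. length xs = n})"
    by auto
  also have "\<dots> \<lesssim> A"
    using assms len by (intro UN_lepoll_infinite) (auto simp: infinite_le_lepoll)
  finally show ?thesis .
qed

lemma polys_over_lepoll_infinite:
  assumes "infinite M" "0 \<in> M"
  shows "polys_over M \<lesssim> M"
  using subset_image_lepoll[OF polys_over_subset_Poly_lists] lists_lepoll_infinite assms lepoll_trans
  by blast

text \<open>Each nonzero polynomial has finitely many roots, and \<open>M\<close> bounds the number
  of polynomials.\<close>

lemma roots_lepoll_infinite:
  fixes M :: "'a::idom set"
  assumes "infinite M" "0 \<in> M"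
  shows "{x. \<exists>p\<in>polys_over M. p \<noteq> 0 \<and> poly p x = 0} \<lesssim> M"
proof -
  have "{x. \<exists>p\<in>polys_over M. p \<noteq> 0 \<and> poly p x = 0} = (\<Union>p\<in>polys_over M - {0}. {x. poly p x = 0})"
    by auto
  also have "\<dots> \<lesssim> M"
  proof (rule UN_lepoll_infinite[OF assms(1)])
    show "polys_over M - {0} \<lesssim> M"
      using polys_over_lepoll_infinite[OF assms] subset_imp_lepoll[of "polys_over M - {0}" "polys_over M"]
        lepoll_trans by blast
    show "{x. poly p x = 0} \<lesssim> M" if "p \<in> polys_over M - {0}" for p
      using that assms(1) by (intro finite_lepoll_infinite poly_roots_finite) auto
  qed
  finally show ?thesis .
qed

section \<open>Counting Borel sets by codes\<close>

datatype borel_code = Basic nat | Complement borel_code | Countable_Union "nat \<Rightarrow> borel_code"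

primrec decode :: "'a set \<Rightarrow> (nat \<Rightarrow> 'a set) \<Rightarrow> borel_code \<Rightarrow> 'a set" where
  "decode S G (Basic n) = G n"
| "decode S G (Complement c) = S - decode S G c"
| "decode S G (Countable_Union f) = (\<Union>n. decode S G (f n))"

text \<open>A code is determined by the labels at its finite paths, so there are only continuum many.\<close>

primrec code_label :: "borel_code \<Rightarrow> nat list \<Rightarrow> nat" where
  "code_label (Basic n) = (\<lambda>xs. Suc (Suc n))"
| "code_label (Complement c) = (\<lambda>xs. case xs of [] \<Rightarrow> 0 | _ # ys \<Rightarrow> code_label c ys)"
| "code_label (Countable_Union f) = (\<lambda>xs. case xs of [] \<Rightarrow> 1 | n # ys \<Rightarrow> code_label (f n) ys)"

text \<open>The label at the empty path identifies the root constructor, and the index of a basic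
  set. Paths that start with a child index read off the labelling of that child, so induction
  applies.\<close>

lemma code_label_inject: "code_label c = code_label d \<Longrightarrow> c = d"
proof (induction c arbitrary: d)
  case (Basic n)
  from fun_cong[OF this, of "[]"] show ?case
    by (cases d) auto
next
  case (Complement c)
  from fun_cong[OF Complement.prems, of "[]"] obtain d' where d: "d = Complement d'"
    by (cases d) auto
  have "code_label c ys = code_label d' ys" for ys
    using fun_cong[OF Complement.prems, of "0 # ys"] d by simp
  then show ?case
    using Complement.IH d by blast
next
  case (Countable_Union f)
  from fun_cong[OF Countable_Union.prems, of "[]"] obtain g where d: "d = Countable_Union g"
    by (cases d) auto
  have "code_label (f n) ys = code_label (g n) ys" for n ys
    using fun_cong[OF Countable_Union.prems, of "n # ys"] d by simp
  then have "f n = g n" for n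
    using Countable_Union.IH by blast
  then show ?case
    using d by blast
qed

text \<open>The graph of a labelling is a subset of a countable type, hence becomes a set of
  naturals under \<open>to_nat\<close>.\<close>

lemma borel_code_lepoll: "(UNIV :: borel_code set) \<lesssim> (UNIV :: nat set set)"
proof -
  define h :: "borel_code \<Rightarrow> nat set"
    where "h c = {to_nat (xs, code_label c xs) | xs. True}" for c
  have "inj h"
  proof
    fix c d assume eq: "h c = h d"
    have "code_label c xs = code_label d xs" for xs
    proof -
      have "to_nat (xs, code_label c xs) \<in> h d"
        using eq unfolding h_def by blast
      then show ?thesis
        by (auto simp: h_def)
    qed
    then show "c = d"
      using code_label_inject by blast
  qed
  then show ?thesis
    unfolding lepoll_def by blast
qed

lemma sigma_sets_lepoll:
  assumes "countable \<B>"
  shows "sigma_sets S \<B> \<lesssim> (UNIV :: nat set set)"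
proof -
  \<comment> \<open>Adding \<open>{}\<close> makes the family nonempty, so that it can be
    enumerated, and supplies a code for the empty set.\<close>
  define G where "G = from_nat_into (insert {} \<B>)"
  have G: "range G = insert {} \<B>"
    unfolding G_def using assms by (intro range_from_nat_into) auto
  have "A \<in> range (decode S G)" if "A \<in> sigma_sets S \<B>" for A
    using that
  proof induction
    case (Basic a)
    then obtain n where "a = G n"
      using G by (metis imageE insertCI)
    then show ?case
      by (metis decode.simps(1) rangeI)
  next
    case Empty
    obtain n where "{} = G n"
      using G by (metis imageE insertCI)
    then show ?case
      by (metis decode.simps(1) rangeI)
  next
    case (Compl a)
    then show ?case
      by (metis (no_types) decode.simps(2) rangeE rangeI)
  next
    case (Union a)
    then have "\<forall>i. \<exists>c. a i = decode S G c"
      by blast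
    then obtain f where "\<And>i. a i = decode S G (f i)"
      by metis
    then have "(\<Union>i. a i) = decode S G (Countable_Union f)"
      by simp
    then show ?case
      by blast
  qed
  then have "sigma_sets S \<B> \<lesssim> (UNIV :: borel_code set)"
    by (intro subset_image_lepoll) blast
  then show ?thesis
    using borel_code_lepoll lepoll_trans by blast
qed

lemma sets_borel_lepoll:
  "sets (borel :: 'a::second_countable_topology measure) \<lesssim> (UNIV :: nat set set)"
proof -
  obtain \<B> :: "'a set set" where \<B>: "countable \<B>" "topological_basis \<B>"
    using ex_countable_basis by blast
  then have "sets borel = sigma_sets UNIV \<B>"
    by (subst borel_eq_countable_basis[OF \<B>]) (rule sets_measure_of, simp)
  then show ?thesis
    using sigma_sets_lepoll[OF \<B>(1)] by simp
qed

section \<open>From the order topology to traces of Borel sets\<close>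

text \<open>Rays of \<open>K\<close> are traces of open rays of the ambient order, and traces of
  Borel sets are closed under complements in \<open>K\<close> and countable unions. Thus Borel sets
  for varying \<open>K\<close> can all be compared with Borel sets of one fixed space.\<close>

lemma borel_sets_of_order_topology_imp_trace:
  fixes K :: "'a::{second_countable_topology, linorder_topology} set"
  assumes "D \<in> borel_sets_of (order_topology_on K)"
  shows "\<exists>C\<in>sets borel. D = K \<inter> C"
proof -
  let ?S = "insert K ((\<lambda>a. {x \<in> K. x < a}) ` K \<union> (\<lambda>a. {x \<in> K. a < x}) ` K)"
  have top: "topspace (order_topology_on K) = K"
    by (auto simp: order_topology_on_def)
  have op: "\<exists>V. open V \<and> U = K \<inter> V" if "openin (order_topology_on K) U" for U
  proof -
    have "generate_topology_on ?S U"
      using that by (simp add: order_topology_on_def openin_topology_generated_by_iff)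
    then show ?thesis
    proof induction
      case Empty
      then show ?case by blast
    next
      case (Int a b)
      then obtain V W where "open V" "a = K \<inter> V" "open W" "b = K \<inter> W"
        by blast
      then have "open (V \<inter> W) \<and> a \<inter> b = K \<inter> (V \<inter> W)"
        by blast
      then show ?case
        by blast
    next
      case (UN \<U>)
      then obtain V where V: "\<And>k. k \<in> \<U> \<Longrightarrow> open (V k) \<and> k = K \<inter> V k"
        by metis
      then have "open (\<Union>k\<in>\<U>. V k)"
        by blast
      moreover have "\<Union>\<U> = K \<inter> (\<Union>k\<in>\<U>. V k)"
        using V by blast
      ultimately show ?case
        by blast
    next
      case (Basis s)
      consider "s = K" | a where "s = K \<inter> {..<a}" | a where "s = K \<inter> {a<..}"
        using Basis by auto
      then show ?case
      proof cases
        case 1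
        then show ?thesis
          by (intro exI[of _ UNIV]) simp
      qed (use open_lessThan open_greaterThan in blast)+
    qed
  qed
  have "D \<in> sigma_sets K {U. openin (order_topology_on K) U}"
    using assms by (simp add: borel_sets_of_def top)
  then show ?thesis
  proof induction
    case (Basic a)
    then show ?case
      using op borel_open by blast
  next
    case Empty
    then show ?case by blast
  next
    case (Compl a)
    then obtain C where "C \<in> sets borel" "a = K \<inter> C"
      by blast
    then show ?case
      by (intro bexI[of _ "- C"]) auto
  next
    case (Union a)
    then obtain C where C: "\<And>i. C i \<in> sets borel" "\<And>i. a i = K \<inter> C i"
      by metis
    then show ?case
      by (intro bexI[of _ "\<Union>i. C i"]) auto
  qed
qed

section \<open>A large subring with a transcendental element\<close>

definition ring_closed :: "'a::comm_ring_1 set \<Rightarrow> bool" where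
  "ring_closed M \<longleftrightarrow> 1 \<in> M \<and> (\<forall>x\<in>M. \<forall>y\<in>M. x - y \<in> M \<and> x * y \<in> M)"

text \<open>By the convention \<open>inverse 0 = 0\<close>, zero needs no exception.\<close>

definition field_closed :: "'a::field set \<Rightarrow> bool" where
  "field_closed K \<longleftrightarrow> ring_closed K \<and> (\<forall>x\<in>K. inverse x \<in> K)"

lemma ring_closedD:
  assumes "ring_closed M"
  shows "0 \<in> M" "1 \<in> M"
    and "x \<in> M \<Longrightarrow> - x \<in> M"
    and "x \<in> M \<Longrightarrow> y \<in> M \<Longrightarrow> x - y \<in> M"
    and "x \<in> M \<Longrightarrow> y \<in> M \<Longrightarrow> x + y \<in> M"
    and "x \<in> M \<Longrightarrow> y \<in> M \<Longrightarrow> x * y \<in> M"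
proof -
  have diff: "x - y \<in> M" if "x \<in> M" "y \<in> M" for x y
    using assms that by (auto simp: ring_closed_def)
  show "1 \<in> M" and "x \<in> M \<Longrightarrow> y \<in> M \<Longrightarrow> x * y \<in> M"
    using assms by (auto simp: ring_closed_def)
  then show zero: "0 \<in> M"
    using diff by (metis diff_self)
  have minus: "- x \<in> M" if "x \<in> M" for x
    using diff[OF zero that] by simp
  then show "x \<in> M \<Longrightarrow> - x \<in> M" .
  show "x \<in> M \<Longrightarrow> y \<in> M \<Longrightarrow> x - y \<in> M"
    by (rule diff)
  show "x \<in> M \<Longrightarrow> y \<in> M \<Longrightarrow> x + y \<in> M"
    using diff[of x "- y"] minus[of y] by simp
qed

lemma ring_closed_sum:
  assumes "ring_closed M" "\<And>i. i \<in> I \<Longrightarrow> f i \<in> M"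
  shows "sum f I \<in> M"
  using assms(2) by (induction I rule: infinite_finite_induct) (auto intro: ring_closedD[OF assms(1)])

lemma ring_closed_prod:
  assumes "ring_closed M" "\<And>i. i \<in> I \<Longrightarrow> f i \<in> M"
  shows "prod f I \<in> M"
  using assms(2) by (induction I rule: infinite_finite_induct) (auto intro: ring_closedD[OF assms(1)])

lemma ring_closed_Union_chain:
  assumes "\<C> \<noteq> {}" "\<And>M. M \<in> \<C> \<Longrightarrow> ring_closed M"
    and chain: "\<And>M N. M \<in> \<C> \<Longrightarrow> N \<in> \<C> \<Longrightarrow> M \<subseteq> N \<or> N \<subseteq> M"
  shows "ring_closed (\<Union>\<C>)"
  unfolding ring_closed_def
proof (intro conjI ballI)
  show "1 \<in> \<Union>\<C>"
    using assms(1,2) ring_closedD(2) by blast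
  fix x y assume "x \<in> \<Union>\<C>" "y \<in> \<Union>\<C>"
  then obtain M N where "M \<in> \<C>" "x \<in> M" "N \<in> \<C>" "y \<in> N"
    by blast
  then obtain L where L: "L \<in> \<C>" "x \<in> L" "y \<in> L"
    using chain by blast
  then show "x - y \<in> \<Union>\<C>" "x * y \<in> \<Union>\<C>"
    using assms(2) ring_closedD(4,6) by blast+
qed

lemma ring_closed_polys_over:
  assumes "ring_closed M"
  shows "ring_closed (polys_over M)"
  unfolding ring_closed_def
proof (intro conjI ballI)
  note * = ring_closedD[OF assms]
  show "1 \<in> polys_over M"
    using * by (simp add: polys_over_def)
  fix p q assume pq: "p \<in> polys_over M" "q \<in> polys_over M"
  show "p - q \<in> polys_over M"
    using pq * by (simp add: polys_over_def)
  show "p * q \<in> polys_over M"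
    using pq * by (auto simp: polys_over_def Polynomial.coeff_mult intro!: ring_closed_sum[OF assms])
qed

lemma pCons_in_polys_over:
  assumes "a \<in> M" "p \<in> polys_over M"
  shows "pCons a p \<in> polys_over M"
  using assms by (auto simp: polys_over_def coeff_pCons split: nat.splits)

lemma zero_in_polys_over: "0 \<in> M \<Longrightarrow> 0 \<in> polys_over M"
  by (simp add: polys_over_def)

text \<open>For a subring \<open>M\<close> this is the ring usually written
  \<open>M[x]\<close>.\<close>

definition adjoin :: "'a::comm_ring_1 set \<Rightarrow> 'a \<Rightarrow> 'a set" where
  "adjoin M x = (\<lambda>p. poly p x) ` polys_over M"

lemma ring_closed_adjoin:
  assumes "ring_closed M"
  shows "ring_closed (adjoin M x)"
  unfolding ring_closed_def adjoin_def
proof (intro conjI ballI)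
  note * = ring_closedD[OF ring_closed_polys_over[OF assms]]
  show "1 \<in> (\<lambda>p. poly p x) ` polys_over M"
    using *(2) by (intro image_eqI[of _ _ 1]) auto
  fix a b assume "a \<in> (\<lambda>p. poly p x) ` polys_over M" "b \<in> (\<lambda>p. poly p x) ` polys_over M"
  then obtain p q where pq: "p \<in> polys_over M" "q \<in> polys_over M" "a = poly p x" "b = poly q x"
    by blast
  then show "a - b \<in> (\<lambda>p. poly p x) ` polys_over M"
    using * by (intro image_eqI[of _ _ "p - q"]) auto
  show "a * b \<in> (\<lambda>p. poly p x) ` polys_over M"
    using * pq by (intro image_eqI[of _ _ "p * q"]) auto
qed

lemma subset_adjoin:
  assumes "ring_closed M"
  shows "M \<subseteq> adjoin M x"
proof
  fix a assume "a \<in> M"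
  then show "a \<in> adjoin M x"
    using ring_closedD(1)[OF assms]
    by (auto simp: adjoin_def intro!: image_eqI[of _ _ "[:a:]"] pCons_in_polys_over zero_in_polys_over)
qed

lemma in_adjoin:
  assumes "ring_closed M"
  shows "x \<in> adjoin M x"
  using ring_closedD(1,2)[OF assms]
  by (auto simp: adjoin_def intro!: image_eqI[of _ _ "[:0, 1:]"] pCons_in_polys_over zero_in_polys_over)

section \<open>Transcendence and maximal subrings\<close>

definition transcendental_over :: "'a::comm_ring_1 \<Rightarrow> 'a set \<Rightarrow> bool" where
  "transcendental_over t M \<longleftrightarrow> (\<forall>p\<in>polys_over M. poly p t = 0 \<longrightarrow> p = 0)"

text \<open>Countably many polynomials with finitely many roots each cannot exhaust the interval
  from \<open>0\<close> to \<open>1\<close>. Positivity later makes \<open>t + s\<close> a square in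
  the reals for all \<open>s \<ge> 0\<close>.\<close>

lemma exists_transcendental_over_Rats: "\<exists>t::real. t > 0 \<and> transcendental_over t \<rat>"
proof -
  have "countable (Poly ` lists (\<rat> :: real set))"
    by (intro countable_image countable_lists countable_rat)
  then have "countable (polys_over (\<rat> :: real set))"
    by (rule countable_subset[OF polys_over_subset_Poly_lists, rotated]) simp
  then have "countable (polys_over (\<rat> :: real set) - {0})"
    by (rule countable_Diff)
  then have "countable (\<Union>p\<in>polys_over \<rat> - {0}. {x::real. poly p x = 0})"
    by (rule countable_UN) (auto intro: countable_finite poly_roots_finite)
  moreover have "uncountable {0<..<1::real}"
    by (simp add: uncountable_open_interval)
  ultimately obtain t :: real where "t \<in> {0<..<1}" "t \<notin> (\<Union>p\<in>polys_over \<rat> - {0}. {x. poly p x = 0})"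
    by (meson countable_subset subsetI)
  then show ?thesis
    by (intro exI[of _ t]) (auto simp: transcendental_over_def)
qed

text \<open>Zorn's lemma applies because a polynomial has finitely many coefficients: over the union
  of a chain it is already a polynomial over one member.\<close>

lemma maximal_transcendental_subring:
  fixes t :: "'a::comm_ring_1"
  assumes "ring_closed M0" "transcendental_over t M0"
  obtains M where "ring_closed M" "M0 \<subseteq> M" "transcendental_over t M"
    "\<And>x. x \<notin> M \<Longrightarrow> \<not> transcendental_over t (adjoin M x)"
proof -
  let ?Z = "{M. ring_closed M \<and> M0 \<subseteq> M \<and> transcendental_over t M}"
  have "\<exists>M\<in>?Z. \<forall>N\<in>?Z. M \<subseteq> N \<longrightarrow> N = M"
  proof (rule subset_Zorn_nonempty)
    show "?Z \<noteq> {}"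
      using assms by blast
  next
    fix \<C> assume "\<C> \<noteq> {}" and chain: "subset.chain ?Z \<C>"
    have sub: "\<C> \<subseteq> ?Z" and lin: "\<And>M N. M \<in> \<C> \<Longrightarrow> N \<in> \<C> \<Longrightarrow> M \<subseteq> N \<or> N \<subseteq> M"
      using chain by (auto simp: subset_chain_def)
    have "ring_closed (\<Union>\<C>)"
      using \<open>\<C> \<noteq> {}\<close> sub lin by (intro ring_closed_Union_chain) auto
    moreover have "M0 \<subseteq> \<Union>\<C>"
      using \<open>\<C> \<noteq> {}\<close> sub by blast
    moreover have "transcendental_over t (\<Union>\<C>)"
      unfolding transcendental_over_def
    proof (intro ballI impI)
      fix p assume p: "p \<in> polys_over (\<Union>\<C>)" "poly p t = 0"
      have "set (coeffs p) \<subseteq> \<Union>\<C>"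
        using p by (auto simp: polys_over_def coeffs_def)
      then obtain N where N: "N \<in> \<C>" "set (coeffs p) \<subseteq> N"
        using finite_subset_Union_chain[OF _ _ \<open>\<C> \<noteq> {}\<close> chain] by blast
      have "0 \<in> N"
        using N(1) sub ring_closedD(1) by blast
      then have "range (Polynomial.coeff p) \<subseteq> N"
        using N(2) by (simp add: range_coeff)
      then have "p \<in> polys_over N"
        by (auto simp: polys_over_def)
      then show "p = 0"
        using N(1) sub p(2) by (auto simp: transcendental_over_def)
    qed
    ultimately show "\<Union>\<C> \<in> ?Z"
      by blast
  qed
  then obtain M where "M \<in> ?Z" and max: "\<forall>N\<in>?Z. M \<subseteq> N \<longrightarrow> N = M" ..
  then have M: "ring_closed M" "M0 \<subseteq> M" "transcendental_over t M"
    by simp_all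
  show thesis
  proof (rule that[OF M])
    fix x assume "x \<notin> M"
    then have "adjoin M x \<noteq> M"
      using in_adjoin[OF M(1)] by metis
    then show "\<not> transcendental_over t (adjoin M x)"
      using max ring_closed_adjoin[OF M(1), of x] subset_adjoin[OF M(1), of x] M(2) by auto
  qed
qed

text \<open>A relation for \<open>t\<close> over \<open>M[x]\<close> is a polynomial relation
  between \<open>x\<close> and \<open>t\<close> over \<open>M\<close>. Regrouped by powers of
  \<open>x\<close>, it becomes a relation for \<open>x\<close> over \<open>M[t]\<close>, nontrivial
  because \<open>t\<close> is transcendental over \<open>M\<close>.\<close>

lemma algebraic_exchange:
  fixes t x :: "'a::comm_ring_1"
  assumes M: "ring_closed M" and t: "transcendental_over t M"
    and x: "\<not> transcendental_over t (adjoin M x)"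
  shows "\<not> transcendental_over x (adjoin M t)"
proof -
  obtain p where p: "p \<in> polys_over (adjoin M x)" "p \<noteq> 0" "poly p t = 0"
    using x by (auto simp: transcendental_over_def)
  then have "\<forall>i. \<exists>u\<in>polys_over M. Polynomial.coeff p i = poly u x"
    unfolding polys_over_def[of "adjoin M x"] by (auto simp: adjoin_def)
  then obtain u where u: "\<And>i. u i \<in> polys_over M" "\<And>i. Polynomial.coeff p i = poly (u i) x"
    by metis
  define n where "n = Polynomial.degree p"
  \<comment> \<open>The coefficient of \<open>p\<close> at \<open>i\<close> is \<open>u i\<close>
    evaluated at \<open>x\<close>. Here \<open>t\<close> is inserted for the variable of
    \<open>p\<close> and \<open>x\<close> becomes the variable; \<open>r k\<close> collects the
    coefficients of the \<open>k\<close>-th power of \<open>x\<close> as a polynomial in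
    \<open>t\<close>.\<close>
  define q where "q = (\<Sum>i\<le>n. Polynomial.smult (t ^ i) (u i))"
  define r where "r k = (\<Sum>i\<le>n. Polynomial.monom (Polynomial.coeff (u i) k) i)" for k
  have coeff_r: "Polynomial.coeff (r k) i = (if i \<le> n then Polynomial.coeff (u i) k else 0)" for k i
    by (auto simp: r_def coeff_sum if_distrib cong: if_cong)
  have r: "r k \<in> polys_over M" for k
    using u(1) ring_closedD(1)[OF M] by (auto simp: polys_over_def coeff_r)
  have coeff_q: "Polynomial.coeff q k = poly (r k) t" for k
    by (simp add: q_def r_def coeff_sum poly_sum poly_monom mult.commute)
  have "q \<in> polys_over (adjoin M t)"
    using r unfolding polys_over_def[of "adjoin M t"] by (auto simp: adjoin_def coeff_q)
  moreover have "poly q x = 0"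
    using p(3) by (simp add: q_def poly_sum poly_altdef[of p] n_def u(2)[symmetric] mult.commute)
  moreover have "q \<noteq> 0"
  proof
    assume "q = 0"
    \<comment> \<open>Transcendence of \<open>t\<close> kills every \<open>r k\<close>, and with
      them \<open>u n\<close>, which yields the leading coefficient of \<open>p\<close>.\<close>
    then have "r k = 0" for k
      using t r coeff_q[of k] by (auto simp: transcendental_over_def)
    then have "Polynomial.coeff (u n) k = 0" for k
      using coeff_r[of k n] by simp
    then have "u n = 0"
      by (simp add: poly_eq_iff)
    then have "Polynomial.coeff p n = 0"
      using u(2)[of n] by simp
    then show False
      using p(2) by (simp add: n_def)
  qed
  ultimately show ?thesis
    by (auto simp: transcendental_over_def)
qed

text \<open>By maximality and exchange, every element outside \<open>M\<close> is a root of a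
  nonzero polynomial over \<open>M[t]\<close>, and so trivially is every element of
  \<open>M\<close>. Hence the whole type is no larger than \<open>M[t]\<close>, which is no larger
  than \<open>M\<close>.\<close>

lemma maximal_transcendental_subring_lepoll:
  fixes M :: "'a::{idom,ring_char_0} set"
  assumes M: "ring_closed M" "transcendental_over t M"
    and max: "\<And>x. x \<notin> M \<Longrightarrow> \<not> transcendental_over t (adjoin M x)"
  shows "(UNIV :: 'a set) \<lesssim> M"
proof -
  have "of_nat n \<in> M" for n
    by (induction n) (auto intro: ring_closedD[OF M(1)])
  then have inf: "infinite M"
    using range_inj_infinite[of "of_nat :: nat \<Rightarrow> 'a"] infinite_super[of "range of_nat" M]
    by (auto simp: inj_of_nat)
  let ?N = "adjoin M t"
  have N: "0 \<in> ?N" "infinite ?N"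
    using ring_closedD(1)[OF ring_closed_adjoin[OF M(1)]]
      infinite_super[OF subset_adjoin[OF M(1)] inf] by auto
  have "x \<in> {x. \<exists>p\<in>polys_over ?N. p \<noteq> 0 \<and> poly p x = 0}" for x
  proof (cases "x \<in> M")
    case True
    then have "[:- x, 1:] \<in> polys_over ?N"
      using subset_adjoin[OF M(1), of t] ring_closedD(1-3)[OF ring_closed_adjoin[OF M(1), of t]]
      by (intro pCons_in_polys_over zero_in_polys_over) auto
    then show ?thesis
      by (auto intro!: bexI[of _ "[:- x, 1:]"])
  next
    case False
    from algebraic_exchange[OF M max[OF this]] show ?thesis
      by (auto simp: transcendental_over_def)
  qed
  then have "(UNIV :: 'a set) \<subseteq> {x. \<exists>p\<in>polys_over ?N. p \<noteq> 0 \<and> poly p x = 0}"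
    by blast
  then have "(UNIV :: 'a set) \<lesssim> {x. \<exists>p\<in>polys_over ?N. p \<noteq> 0 \<and> poly p x = 0}"
    by (rule subset_imp_lepoll)
  also have "\<dots> \<lesssim> ?N"
    by (rule roots_lepoll_infinite[OF N(2,1)])
  also have "?N \<lesssim> polys_over M"
    unfolding adjoin_def by (rule image_lepoll)
  also have "\<dots> \<lesssim> M"
    by (rule polys_over_lepoll_infinite[OF inf ring_closedD(1)[OF M(1)]])
  finally show ?thesis .
qed

section \<open>Prescribing the squares in a field\<close>

lemma field_closed_fractions:
  fixes t :: "'a::field"
  assumes "ring_closed R"
  shows "field_closed {x / y | x y. x \<in> R \<and> y \<in> R \<and> y \<noteq> 0}" (is "field_closed ?F")
proof -
  note * = ring_closedD[OF assms]
  have I: "a \<in> ?F" if "a = x / y" "x \<in> R" "y \<in> R" "y \<noteq> 0" for a x y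
    using that by blast
  have "1 \<in> ?F"
    by (rule I[of _ 1 1]) (use * in auto)
  moreover have "a - b \<in> ?F \<and> a * b \<in> ?F" if ab: "a \<in> ?F" "b \<in> ?F" for a b
  proof -
    obtain x y z w where *: "a = x / y" "b = z / w" "x \<in> R" "y \<in> R" "z \<in> R" "w \<in> R" "y \<noteq> 0" "w \<noteq> 0"
      using ab by blast
    have "a - b = (x * w - z * y) / (y * w)" "a * b = (x * z) / (y * w)"
      using * by (auto simp: field_simps)
    then show ?thesis
      using * ring_closedD[OF assms] by (metis (no_types, lifting) I mult_eq_0_iff)
  qed
  moreover have "inverse a \<in> ?F" if a: "a \<in> ?F" for a
  proof -
    obtain x y where xy: "a = x / y" "x \<in> R" "y \<in> R" "y \<noteq> 0"
      using a by blast
    show ?thesis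
    proof (cases "x = 0")
      case True
      then show ?thesis
        using xy * by (intro I[of _ 0 1]) auto
    next
      case False
      then show ?thesis
        using xy by (intro I[of _ y x]) auto
    qed
  qed
  ultimately show ?thesis
    unfolding field_closed_def ring_closed_def by blast
qed

text \<open>Inverses come from the conjugate \<open>u - v * r\<close>, whose product with
  \<open>u + v * r\<close> is the norm \<open>c\<close> in \<open>L\<close>. If \<open>c = 0\<close>
  with \<open>v \<noteq> 0\<close>, then \<open>r\<close> would be plus or minus
  \<open>u / v\<close>, hence in \<open>L\<close>.\<close>

lemma field_closed_quadratic_extension:
  fixes r :: "'a::field"
  assumes L: "field_closed L" and d: "r ^ 2 \<in> L" "r \<notin> L"
  shows "field_closed {u + v * r | u v. u \<in> L \<and> v \<in> L}" (is "field_closed ?E")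
proof -
  have ring: "ring_closed L" and inv: "\<And>x. x \<in> L \<Longrightarrow> inverse x \<in> L"
    using L by (auto simp: field_closed_def)
  note * = ring_closedD[OF ring]
  have I: "a \<in> ?E" if "a = u + v * r" "u \<in> L" "v \<in> L" for a u v
    using that by blast
  have "1 \<in> ?E"
    by (rule I[of _ 1 0]) (use * in auto)
  moreover have "a - b \<in> ?E \<and> a * b \<in> ?E" if ab: "a \<in> ?E" "b \<in> ?E" for a b
  proof -
    obtain u v u' v' where uv: "a = u + v * r" "b = u' + v' * r" "u \<in> L" "v \<in> L" "u' \<in> L" "v' \<in> L"
      using ab by blast
    have "a - b = (u - u') + (v - v') * r"
      using uv by (simp add: algebra_simps)
    then have "a - b \<in> ?E"
      by (rule I) (intro * uv)+
    moreover have "a * b = (u * u' + v * v' * r ^ 2) + (u * v' + u' * v) * r"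
      using uv by (simp add: algebra_simps power2_eq_square)
    then have "a * b \<in> ?E"
      by (rule I) (intro * uv d)+
    ultimately show ?thesis
      by blast
  qed
  moreover have "inverse a \<in> ?E" if a: "a \<in> ?E" for a
  proof -
    obtain u v where uv: "a = u + v * r" "u \<in> L" "v \<in> L"
      using a by blast
    define c where "c = u ^ 2 - v ^ 2 * r ^ 2"
    have c: "c \<in> L"
      unfolding c_def power2_eq_square[of u] power2_eq_square[of v] by (intro * uv d)
    have ac: "a * (u - v * r) = c"
      using uv by (simp add: c_def algebra_simps power2_eq_square)
    show ?thesis
    proof (cases "c = 0")
      case True
      have "v = 0"
      proof (rule ccontr)
        assume "v \<noteq> 0"
        then have "r ^ 2 = (u * inverse v) ^ 2"
          using True by (simp add: c_def field_simps)
        then have "r = u * inverse v \<or> r = - (u * inverse v)"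
          by (simp add: power2_eq_iff)
        moreover have "u * inverse v \<in> L"
          by (intro * inv uv)
        ultimately show False
          using *(3) d(2) by blast
      qed
      then show ?thesis
        using uv inv by (intro I[of _ "inverse u" 0]) (auto intro: *)
    next
      case False
      then have "a \<noteq> 0"
        using ac by auto
      then have "inverse a = (u - v * r) * inverse c"
        unfolding ac[symmetric] using False ac by (auto simp: field_simps)
      then have "inverse a = u * inverse c + (- (v * inverse c)) * r"
        by (simp add: algebra_simps)
      then show ?thesis
        by (rule I) (intro * inv uv c)+
    qed
  qed
  ultimately show ?thesis
    unfolding field_closed_def ring_closed_def by blast
qed

text \<open>Expanding the square leaves the coefficient \<open>2 * u * v\<close> at
  \<open>r\<close>. It must vanish, as otherwise one could solve for \<open>r\<close> within
  \<open>L\<close>; in characteristic zero this means \<open>u = 0\<close> or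
  \<open>v = 0\<close>.\<close>

lemma square_in_quadratic_extension:
  fixes r :: "'a::field_char_0"
  assumes L: "field_closed L" and d: "r ^ 2 \<in> L" "r \<notin> L"
    and uv: "u \<in> L" "v \<in> L" and f: "(u + v * r) ^ 2 \<in> L"
  shows "(u + v * r) ^ 2 = u ^ 2 \<or> (u + v * r) ^ 2 = v ^ 2 * r ^ 2"
proof -
  have ring: "ring_closed L" and inv: "\<And>x. x \<in> L \<Longrightarrow> inverse x \<in> L"
    using L by (auto simp: field_closed_def)
  note * = ring_closedD[OF ring]
  have eq: "(u + v * r) ^ 2 = u * u + v * v * r ^ 2 + (u * v + u * v) * r"
    by (simp add: algebra_simps power2_eq_square)
  have "u * v + u * v = 0"
  proof (rule ccontr)
    assume nz: "u * v + u * v \<noteq> 0"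
    have "((u + v * r) ^ 2 - (u * u + v * v * r ^ 2)) * inverse (u * v + u * v)
        = r * ((u * v + u * v) * inverse (u * v + u * v))"
      unfolding eq by (simp add: mult_ac)
    also have "\<dots> = r"
      by (subst right_inverse[OF nz]) simp
    finally have "r = ((u + v * r) ^ 2 - (u * u + v * v * r ^ 2)) * inverse (u * v + u * v)"
      by (rule sym)
    moreover have "\<dots> \<in> L"
      by (intro * inv uv f d(1))
    ultimately show False
      using d(2) by metis
  qed
  then have "u = 0 \<or> v = 0"
    by (simp flip: mult_2)
  then show ?thesis
    by (auto simp: power_mult_distrib)
qed

text \<open>The shifts \<open>t + s\<close> are independent modulo squares of \<open>M(t)\<close>: if their product were a square,
  the order at \<open>- s\<close> of the corresponding identity of polynomials would be odd on one side
  and even on the other.\<close>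

lemma prod_shifts_not_square_fraction:
  fixes t :: "'a::idom"
  assumes M: "ring_closed M" and t: "transcendental_over t M"
    and P: "finite P" "P \<subseteq> M" "P \<noteq> {}"
    and xy: "x \<in> adjoin M t" "y \<in> adjoin M t" "y \<noteq> 0"
  shows "x ^ 2 \<noteq> y ^ 2 * (\<Prod>s\<in>P. t + s)"
proof
  assume eq: "x ^ 2 = y ^ 2 * (\<Prod>s\<in>P. t + s)"
  obtain p q where p: "p \<in> polys_over M" "x = poly p t" and q: "q \<in> polys_over M" "y = poly q t"
    using xy by (auto simp: adjoin_def)
  define g where "g Q = (\<Prod>s\<in>Q. [:s, 1:])" for Q :: "'a set"
  note * = ring_closedD[OF ring_closed_polys_over[OF M]]
  have "g P \<in> polys_over M"
    unfolding g_def using P(2) ring_closedD(1,2)[OF M]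
    by (intro ring_closed_prod ring_closed_polys_over[OF M] pCons_in_polys_over zero_in_polys_over) auto
  then have "p * p - q * q * g P \<in> polys_over M"
    by (intro * p(1) q(1))
  moreover have "poly (p * p - q * q * g P) t = 0"
    using eq p q by (simp add: g_def poly_prod power2_eq_square add.commute)
  \<comment> \<open>Transcendence of \<open>t\<close> lifts the identity of values at
    \<open>t\<close> to an identity of polynomials.\<close>
  ultimately have id: "p * p = q * q * g P"
    using t by (auto simp: transcendental_over_def)
  obtain s where s: "s \<in> P"
    using P(3) by blast
  have g: "g P = [:s, 1:] * g (P - {s})"
    unfolding g_def using P(1) s by (rule prod.remove)
  have gnz: "g Q \<noteq> 0" if "finite Q" for Q
    using that by (simp add: g_def)
  have "q \<noteq> 0"
    using xy(3) q by auto
  then have nz: "q * q \<noteq> 0" "p \<noteq> 0"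
    using id gnz[of P] P(1) by auto
  \<comment> \<open>The factors belong to distinct shifts, so only \<open>[:s, 1:]\<close> vanishes
    at \<open>- s\<close>.\<close>
  have "Polynomial.order (- s) (g (P - {s})) = 0"
    using P(1) by (intro order_0I) (auto simp: g_def poly_prod add_eq_0_iff2)
  moreover have "Polynomial.order (- s) [:s, 1:] = 1"
    using order_power_n_n[of "- s" 1] by simp
  ultimately have "Polynomial.order (- s) (g P) = 1"
    using gnz[of P] P(1) unfolding g by (subst order_mult) auto
  moreover have "Polynomial.order (- s) (p * p) = Polynomial.order (- s) (q * q * g P)"
    by (simp only: id)
  ultimately have "2 * Polynomial.order (- s) p = 2 * Polynomial.order (- s) q + 1"
    using nz gnz[of P] P(1) \<open>q \<noteq> 0\<close> by (simp add: order_mult)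
  then show False
    by presburger
qed

section \<open>Maximal fields with controlled squares\<close>

text \<open>\<open>K\<close> is maximal among the fields in which a finite product of distinct
  shifts is a square only if all its shifts come from \<open>A\<close>. One-element products show
  that no other shift is a square; maximality forces the shifts from \<open>A\<close> to be
  squares.\<close>

theorem exists_field_with_prescribed_squares:
  fixes t :: real
  assumes M: "ring_closed M" and t: "transcendental_over t M" "t > 0"
    and A: "A \<subseteq> {s \<in> M. s \<ge> 0}"
  obtains K where "field_closed K" "M \<subseteq> K" "t \<in> K"
    "\<And>s. s \<in> M \<Longrightarrow> s \<ge> 0 \<Longrightarrow> (\<exists>z\<in>K. z ^ 2 = t + s) \<longleftrightarrow> s \<in> A"
proof -
  define S where "S = {s \<in> M. s \<ge> 0}"
  \<comment> \<open>Products are included to make the condition stable: adjoining a root of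
    \<open>t + a\<close> also makes \<open>t + s\<close> a square when
    \<open>(t + a) * (t + s)\<close> was one already.\<close>
  define \<Phi> where "\<Phi> L \<longleftrightarrow> (\<forall>P z. finite P \<longrightarrow> P \<subseteq> S \<longrightarrow> z \<in> L \<longrightarrow> z ^ 2 = (\<Prod>s\<in>P. t + s) \<longrightarrow> P \<subseteq> A)"
    for L :: "real set"
  let ?Z = "{L. field_closed L \<and> adjoin M t \<subseteq> L \<and> \<Phi> L}"
  let ?F = "{x / y | x y. x \<in> adjoin M t \<and> y \<in> adjoin M t \<and> y \<noteq> 0}"
  have "\<exists>K\<in>?Z. \<forall>L\<in>?Z. K \<subseteq> L \<longrightarrow> L = K"
  proof (rule subset_Zorn_nonempty)
    have "\<Phi> ?F"
      unfolding \<Phi>_def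
    proof (intro allI impI)
      fix P z assume P: "finite P" "P \<subseteq> S" "z \<in> ?F" and z: "z ^ 2 = (\<Prod>s\<in>P. t + s)"
      then obtain x y where xy: "x \<in> adjoin M t" "y \<in> adjoin M t" "y \<noteq> 0" "z = x / y"
        by blast
      then have "x ^ 2 = y ^ 2 * (\<Prod>s\<in>P. t + s)"
        using z by (auto simp: field_simps)
      moreover have "P \<subseteq> M"
        using P by (auto simp: S_def)
      ultimately have "P = {}"
        using prod_shifts_not_square_fraction[OF M t(1) P(1)] xy by blast
      then show "P \<subseteq> A"
        by blast
    qed
    moreover have "field_closed ?F"
      by (intro field_closed_fractions ring_closed_adjoin M)
    moreover have "adjoin M t \<subseteq> ?F"
    proof
      fix x assume "x \<in> adjoin M t"
      then show "x \<in> ?F"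
        using ring_closedD(2)[OF ring_closed_adjoin[OF M]]
        by (intro CollectI exI[of _ x] exI[of _ 1]) auto
    qed
    ultimately show "?Z \<noteq> {}"
      by blast
  next
    fix \<C> assume "\<C> \<noteq> {}" and chain: "subset.chain ?Z \<C>"
    have sub: "\<C> \<subseteq> ?Z" and lin: "\<And>M N. M \<in> \<C> \<Longrightarrow> N \<in> \<C> \<Longrightarrow> M \<subseteq> N \<or> N \<subseteq> M"
      using chain by (auto simp: subset_chain_def)
    have "ring_closed (\<Union>\<C>)"
      using \<open>\<C> \<noteq> {}\<close> sub lin by (intro ring_closed_Union_chain) (auto simp: field_closed_def)
    moreover have "\<forall>x\<in>\<Union>\<C>. inverse x \<in> \<Union>\<C>"
      using sub by (auto simp: field_closed_def)
    moreover have "adjoin M t \<subseteq> \<Union>\<C>"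
      using \<open>\<C> \<noteq> {}\<close> sub by blast
    \<comment> \<open>Each instance of the condition involves a single \<open>z\<close>, which lies
      in one member of the chain.\<close>
    moreover have "\<Phi> (\<Union>\<C>)"
      using sub unfolding \<Phi>_def by blast
    ultimately show "\<Union>\<C> \<in> ?Z"
      by (simp add: field_closed_def)
  qed
  then obtain K where "K \<in> ?Z" and max: "\<forall>L\<in>?Z. K \<subseteq> L \<longrightarrow> L = K" ..
  then have K: "field_closed K" "adjoin M t \<subseteq> K" "\<Phi> K"
    by simp_all
  have ring: "ring_closed K" and inv: "\<And>x. x \<in> K \<Longrightarrow> inverse x \<in> K"
    using K(1) by (auto simp: field_closed_def)
  note * = ring_closedD[OF ring]
  have MK: "M \<subseteq> K" and tK: "t \<in> K"
    using K(2) subset_adjoin[OF M, of t] in_adjoin[OF M, of t] by auto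
  have shift: "t + s \<in> K" if "s \<in> M" for s
    using *(5)[OF tK] MK that by blast
  have "\<exists>z\<in>K. z ^ 2 = t + a" if a: "a \<in> A" for a
  proof (rule ccontr)
    assume contra: "\<not> ?thesis"
    have aS: "a \<in> S" and "a \<in> M" "a \<ge> 0"
      using a A by (auto simp: S_def)
    define r where "r = sqrt (t + a)"
    have r2: "r ^ 2 = t + a"
      using \<open>a \<ge> 0\<close> t(2) by (simp add: r_def)
    then have rK: "r \<notin> K" "r ^ 2 \<in> K"
      using contra shift[OF \<open>a \<in> M\<close>] by auto
    let ?E = "{u + v * r | u v. u \<in> K \<and> v \<in> K}"
    have KE: "K \<subseteq> ?E"
    proof
      fix x assume "x \<in> K"
      then show "x \<in> ?E"
        using *(1) by (intro CollectI exI[of _ x] exI[of _ 0]) auto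
    qed
    have rE: "r \<in> ?E"
      using *(1,2) by (intro CollectI exI[of _ 0] exI[of _ 1]) auto
    have "\<Phi> ?E"
      unfolding \<Phi>_def
    proof (intro allI impI)
      fix P z assume P: "finite P" "P \<subseteq> S" "z \<in> ?E" and z: "z ^ 2 = (\<Prod>s\<in>P. t + s)"
      obtain u v where uv: "u \<in> K" "v \<in> K" "z = u + v * r"
        using P by blast
      have "(\<Prod>s\<in>P. t + s) \<in> K"
        using P(2) by (intro ring_closed_prod ring shift) (auto simp: S_def)
      \<comment> \<open>A product that becomes a square in the extension was a square in
        \<open>K\<close>, or is \<open>t + a\<close> times a square of \<open>K\<close>.\<close>
      then consider "u ^ 2 = (\<Prod>s\<in>P. t + s)" | "v ^ 2 * (t + a) = (\<Prod>s\<in>P. t + s)"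
        using square_in_quadratic_extension[OF K(1) rK(2,1) uv(1,2)] z uv(3) r2 by metis
      then show "P \<subseteq> A"
      proof cases
        case 1
        then show ?thesis
          using K(3) P uv(1) unfolding \<Phi>_def by blast
      next
        case 2
        show ?thesis
        proof (cases "a \<in> P")
          case True
          have "(\<Prod>s\<in>P. t + s) = (t + a) * (\<Prod>s\<in>P - {a}. t + s)"
            using P(1) True by (rule prod.remove)
          \<comment> \<open>The factor \<open>t + a\<close> is positive and cancels, leaving the
            product without \<open>a\<close>.\<close>
          then have "v ^ 2 = (\<Prod>s\<in>P - {a}. t + s)"
            using 2 t(2) \<open>a \<ge> 0\<close> by auto
          then have "P - {a} \<subseteq> A"
            using K(3) P uv(2) unfolding \<Phi>_def by (meson Diff_subset finite_Diff order_trans)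
          then show ?thesis
            using a by blast
        next
          case False
          \<comment> \<open>Here \<open>a\<close> is a new shift: multiplying by
            \<open>t + a\<close> once more gives a square in \<open>K\<close> that is the product
            over \<open>insert a P\<close>.\<close>
          have "(v * (t + a)) ^ 2 = (t + a) * (\<Prod>s\<in>P. t + s)"
            using 2 by (simp flip: 2 add: power2_eq_square)
          then have "(v * (t + a)) ^ 2 = (\<Prod>s\<in>insert a P. t + s)"
            using False P(1) by simp
          moreover have "v * (t + a) \<in> K"
            by (intro *(6) uv(2) shift \<open>a \<in> M\<close>)
          ultimately have "insert a P \<subseteq> A"
            using K(3) P aS unfolding \<Phi>_def by (meson finite_insert insert_subset)
          then show ?thesis
            by blast
        qed
      qed
    qed
    then have EZ: "?E \<in> ?Z"
      using field_closed_quadratic_extension[OF K(1) rK(2,1)] order_trans[OF K(2) KE] by simp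
    have "?E = K"
      by (rule mp[OF bspec[OF max EZ] KE])
    then show False
      using rE rK(1) by simp
  qed
  moreover have "s \<in> A" if s: "s \<in> M" "s \<ge> 0" and z: "z \<in> K" "z ^ 2 = t + s" for s z
  proof -
    have "{s} \<subseteq> S" "z ^ 2 = (\<Prod>s\<in>{s}. t + s)"
      using s z by (auto simp: S_def)
    then show ?thesis
      using K(3) z(1) unfolding \<Phi>_def by (metis finite.emptyI finite.insertI insert_subset)
  qed
  ultimately show thesis
    using that[OF K(1) MK tK] by blast
qed

section \<open>Definable squares\<close>

lemma subfield_real_field:
  assumes "field_closed K"
  shows "subfield K real_field"
proof -
  interpret R: Ring.field "real_field"
    by (rule field_from_type_algebra)
  have ring: "ring_closed K" and inv: "\<And>x. x \<in> K \<Longrightarrow> inverse x \<in> K"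
    using assms by (auto simp: field_closed_def)
  note * = ring_closedD[OF ring]
  have minus: "\<ominus>\<^bsub>real_field\<^esub> x = - x" for x
    by (rule R.minus_equality) (simp_all add: ring_of_type_algebra_def)
  have inverse: "inv\<^bsub>real_field\<^esub> x = inverse x" if "x \<noteq> 0" for x
    using that by (intro R.comm_inv_char) (simp_all add: ring_of_type_algebra_def)
  show ?thesis
  proof (rule R.subfieldI')
    show "subring K real_field"
      by (rule R.subringI) (simp_all add: minus, simp_all add: ring_of_type_algebra_def *)
    show "inv\<^bsub>real_field\<^esub> k \<in> K" if "k \<in> K - {\<zero>\<^bsub>real_field\<^esub>}" for k
      using that inv by (subst inverse) (auto simp: ring_of_type_algebra_def)
  qed
qed

definition square_formula :: ring_formula where
  "square_formula = Exists 1 (Equal (Times (Var 1) (Var 1)) (Var 0))"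

text \<open>Variables \<open>0\<close> and \<open>1\<close> are the object and the parameter for
  \<open>n = l = 1\<close>, so the bound variable is \<open>2\<close>.\<close>

definition sum_square_formula :: ring_formula where
  "sum_square_formula = Exists 2 (Equal (Times (Var 2) (Var 2)) (Plus (Var 0) (Var 1)))"

lemma holds_at_square_formula:
  "holds_at (real_field\<lparr>carrier := K\<rparr>) square_formula [a] \<longleftrightarrow> (\<exists>z\<in>K. z ^ 2 = a)"
  by (simp add: holds_at_def square_formula_def ring_of_type_algebra_def power2_eq_square)

lemma holds_at_sum_square_formula:
  "holds_at (real_field\<lparr>carrier := K\<rparr>) sum_square_formula [a, b] \<longleftrightarrow> (\<exists>z\<in>K. z ^ 2 = a + b)"
  by (simp add: holds_at_def sum_square_formula_def ring_of_type_algebra_def power2_eq_square)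

lemma empty_definable_squares:
  "empty_definable (real_field\<lparr>carrier := K\<rparr>) {x \<in> K. \<exists>z\<in>K. z ^ 2 = x}"
  unfolding empty_definable_def
  by (intro exI[of _ square_formula]) (auto simp: holds_at_square_formula, auto simp: square_formula_def)

text \<open>Reciprocals \<open>1 / (n + 2)\<close> keep the translates of \<open>\<nat>\<close> for different codes \<open>n\<close> disjoint.\<close>

definition pattern_set :: "real set" where
  "pattern_set = {1 / (real n + 2) + real i | n i. i \<in> set_decode n}"

text \<open>The reciprocal lies strictly between \<open>0\<close> and \<open>1\<close>, so the
  number determines first \<open>i\<close> and then \<open>n\<close>.\<close>

lemma pattern_set_iff: "1 / (real n + 2) + real i \<in> pattern_set \<longleftrightarrow> i \<in> set_decode n"
proof
  assume "1 / (real n + 2) + real i \<in> pattern_set"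
  then obtain n' i' where *: "i' \<in> set_decode n'" "1 / (real n + 2) + real i = 1 / (real n' + 2) + real i'"
    by (auto simp: pattern_set_def)
  have "0 < 1 / (real m + 2) \<and> 1 / (real m + 2) < 1" for m
    by (simp add: field_simps)
  from this[of n] this[of n'] *(2) have "\<bar>real i - real i'\<bar> < 1"
    by linarith
  then have "i = i'"
    by linarith
  with * show "i \<in> set_decode n"
    by (auto simp: field_simps)
qed (auto simp: pattern_set_def)

lemma pattern_set_subset: "pattern_set \<subseteq> {s \<in> \<rat>. s \<ge> 0}"
  by (auto simp: pattern_set_def)

text \<open>The objects are the naturals \<open>i\<close>, and the parameter for \<open>J\<close> is
  \<open>t\<close> plus the reciprocal attached to the code of \<open>J\<close>. Their sum is
  \<open>t\<close> plus a point that lies in \<open>pattern_set\<close> exactly when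
  \<open>i \<in> J\<close>. The same choices serve every \<open>m\<close>.\<close>

lemma has_IP_if_pattern_set:
  assumes K: "field_closed K" "\<rat> \<subseteq> K" "t \<in> K"
    and squares: "\<And>s. s \<in> \<rat> \<Longrightarrow> s \<ge> 0 \<Longrightarrow> (\<exists>z\<in>K. z ^ 2 = t + s) \<longleftrightarrow> s \<in> pattern_set"
  shows "has_IP (real_field\<lparr>carrier := K\<rparr>)"
proof -
  note ringK = ring_closedD[OF conjunct1[OF K(1)[unfolded field_closed_def]]]
  define a where "a i = [real i]" for i
  define b where "b J = [t + 1 / (real (set_encode J) + 2)]" for J
  have holds: "holds_at (real_field\<lparr>carrier := K\<rparr>) sum_square_formula (a i @ b J) \<longleftrightarrow> i \<in> J"
    if "finite J" for i J
  proof -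
    have "holds_at (real_field\<lparr>carrier := K\<rparr>) sum_square_formula (a i @ b J) \<longleftrightarrow>
        (\<exists>z\<in>K. z ^ 2 = t + (1 / (real (set_encode J) + 2) + real i))"
      by (simp add: a_def b_def holds_at_sum_square_formula algebra_simps)
    also have "\<dots> \<longleftrightarrow> 1 / (real (set_encode J) + 2) + real i \<in> pattern_set"
      by (rule squares) auto
    also have "\<dots> \<longleftrightarrow> i \<in> J"
      using that by (simp add: pattern_set_iff)
    finally show ?thesis .
  qed
  have a: "a i \<in> tuples (real_field\<lparr>carrier := K\<rparr>) 1" for i
    using K(2) by (auto simp: a_def tuples_def)
  have "t + 1 / (real n + 2) \<in> K" for n
  proof -
    have "1 / (real n + 2) \<in> \<rat>"
      by auto
    then show ?thesis
      using K by (intro ringK(5)) auto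
  qed
  then have b: "b J \<in> tuples (real_field\<lparr>carrier := K\<rparr>) 1" for J
    by (auto simp: b_def tuples_def)
  have "formula_has_IP (real_field\<lparr>carrier := K\<rparr>) 1 1 sum_square_formula"
    unfolding formula_has_IP_def
  proof (intro allI impI exI[of _ a] exI[of _ b] conjI ballI a b)
    fix m :: nat and J i assume J: "J \<subseteq> {1..m}"
    then have "finite J"
      using finite_subset by blast
    then show "i \<in> J \<Longrightarrow> holds_at (real_field\<lparr>carrier := K\<rparr>) sum_square_formula (a i @ b J)"
      and "i \<in> {1..m} - J \<Longrightarrow> \<not> holds_at (real_field\<lparr>carrier := K\<rparr>) sum_square_formula (a i @ b J)"
      using holds by auto
  qed
  moreover have "free_vars sum_square_formula \<subseteq> {..<1 + 1}"
    by (auto simp: sum_square_formula_def)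
  ultimately show ?thesis
    unfolding has_IP_def by blast
qed

lemma ring_closed_Rats: "ring_closed (\<rat> :: real set)"
  by (auto simp: ring_closed_def)

section \<open>A field whose set of squares is not Borel\<close>

theorem theorem3p3:
  shows "\<exists>K :: real set.
    subfield K real_field \<and>
    K \<approx> (UNIV :: nat set set) \<and>
    has_IP (real_field\<lparr>carrier := K\<rparr>) \<and>
    (\<exists>D. D \<subseteq> K \<and> D \<notin> borel_sets_of (order_topology_on K) \<and>
         empty_definable (real_field\<lparr>carrier := K\<rparr>) D)"
proof -
  obtain t :: real where t: "t > 0" "transcendental_over t \<rat>"
    using exists_transcendental_over_Rats by blast
  obtain M where M: "ring_closed M" "\<rat> \<subseteq> M" "transcendental_over t M"
    and max: "\<And>x. x \<notin> M \<Longrightarrow> \<not> transcendental_over t (adjoin M x)"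
    using maximal_transcendental_subring[OF ring_closed_Rats t(2)] by blast
  have UM: "(UNIV :: real set) \<lesssim> M"
    by (rule maximal_transcendental_subring_lepoll[OF M(1,3) max])
  \<comment> \<open>Only irrational shifts vary, so that the pattern on the rational ones stays
    intact.\<close>
  define S where "S = {s \<in> M. s \<ge> 0} - \<rat>"
  have US: "(UNIV :: real set) \<lesssim> S"
  proof -
    have inf: "infinite (UNIV :: real set)"
      by (rule infinite_UNIV_char_0)
    \<comment> \<open>Of the covering sets, the rationals are countable and the negatives are an
      image of \<open>S\<close>; hence \<open>S\<close> itself must have the size of the
      reals.\<close>
    have "M \<subseteq> \<rat> \<union> (S \<union> uminus ` S)"
    proof
      fix x assume x: "x \<in> M"
      show "x \<in> \<rat> \<union> (S \<union> uminus ` S)"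
      proof (cases "x \<in> \<rat> \<or> x \<ge> 0")
        case True
        then show ?thesis
          using x by (auto simp: S_def)
      next
        case False
        then have "- x \<in> S"
          using ring_closedD(3)[OF M(1) x] by (auto simp: S_def)
        then have "- (- x) \<in> uminus ` S"
          by (rule imageI)
        then show ?thesis
          by simp
      qed
    qed
    then have "(UNIV :: real set) \<lesssim> \<rat> \<union> (S \<union> uminus ` S)"
      using lepoll_trans[OF UM subset_imp_lepoll] by blast
    then consider "(UNIV :: real set) \<lesssim> (\<rat> :: real set)" | "(UNIV :: real set) \<lesssim> S"
      | "(UNIV :: real set) \<lesssim> uminus ` S"
      using lepoll_Un_cases[OF inf] by meson
    then show ?thesis
    proof cases
      case 1
      then show ?thesis
        using countable_lepoll[OF countable_rat] uncountable_UNIV_real by blast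
    next
      case 3
      then show ?thesis
        using lepoll_trans[OF _ image_lepoll] by blast
    qed
  qed
  have "\<exists>K. A \<subseteq> S \<longrightarrow> field_closed K \<and> M \<subseteq> K \<and> t \<in> K \<and>
      (\<forall>s. s \<in> M \<longrightarrow> s \<ge> 0 \<longrightarrow> ((\<exists>z\<in>K. z ^ 2 = t + s) \<longleftrightarrow> s \<in> pattern_set \<union> A))" for A
  proof (cases "A \<subseteq> S")
    case True
    then have "pattern_set \<union> A \<subseteq> {s \<in> M. s \<ge> 0}"
      using pattern_set_subset M(2) unfolding S_def by blast
    from exists_field_with_prescribed_squares[OF M(1,3) t(1) this] show ?thesis
      by metis
  qed blast
  then have "\<exists>K. \<forall>A. A \<subseteq> S \<longrightarrow> field_closed (K A) \<and> M \<subseteq> K A \<and> t \<in> K A \<and>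
      (\<forall>s. s \<in> M \<longrightarrow> s \<ge> 0 \<longrightarrow> ((\<exists>z\<in>K A. z ^ 2 = t + s) \<longleftrightarrow> s \<in> pattern_set \<union> A))"
    by (intro choice allI)
  then obtain K where "\<forall>A. A \<subseteq> S \<longrightarrow> field_closed (K A) \<and> M \<subseteq> K A \<and> t \<in> K A \<and>
      (\<forall>s. s \<in> M \<longrightarrow> s \<ge> 0 \<longrightarrow> ((\<exists>z\<in>K A. z ^ 2 = t + s) \<longleftrightarrow> s \<in> pattern_set \<union> A))" ..
  then have K: "\<And>A. A \<subseteq> S \<Longrightarrow> field_closed (K A)" "\<And>A. A \<subseteq> S \<Longrightarrow> M \<subseteq> K A"
      "\<And>A. A \<subseteq> S \<Longrightarrow> t \<in> K A"
    and squares: "\<And>A s. A \<subseteq> S \<Longrightarrow> s \<in> M \<Longrightarrow> s \<ge> 0 \<Longrightarrow>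
      (\<exists>z\<in>K A. z ^ 2 = t + s) \<longleftrightarrow> s \<in> pattern_set \<union> A"
    by simp_all
  define D where "D A = {x \<in> K A. \<exists>z\<in>K A. z ^ 2 = x}" for A
  have "\<exists>A\<subseteq>S. D A \<notin> borel_sets_of (order_topology_on (K A))"
  proof (rule ccontr)
    assume "\<not> ?thesis"
    then have "\<forall>A\<in>Pow S. \<exists>C\<in>sets borel. D A = K A \<inter> C"
      using borel_sets_of_order_topology_imp_trace by blast
    then obtain C where C: "\<And>A. A \<in> Pow S \<Longrightarrow> C A \<in> sets borel"
        "\<And>A. A \<in> Pow S \<Longrightarrow> D A = K A \<inter> C A"
      by metis
    \<comment> \<open>The decoding of \<open>A\<close> uses the field only through the Borel set
      \<open>C A\<close>, so \<open>C\<close> is injective on \<open>Pow S\<close> although the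
      fields differ.\<close>
    have "A = {s \<in> S. t + s \<in> C A}" if A: "A \<subseteq> S" for A
    proof -
      have "t + s \<in> C A \<longleftrightarrow> s \<in> A" if s: "s \<in> S" for s
      proof -
        have sM: "s \<in> M" "s \<ge> 0" "s \<notin> pattern_set"
          using s pattern_set_subset by (auto simp: S_def)
        have "t + s \<in> K A"
          using K[OF A] sM(1) by (intro ring_closedD(5)) (auto simp: field_closed_def)
        then have "t + s \<in> C A \<longleftrightarrow> t + s \<in> D A"
          using C(2) A by blast
        also have "\<dots> \<longleftrightarrow> (\<exists>z\<in>K A. z ^ 2 = t + s)"
          using \<open>t + s \<in> K A\<close> by (simp add: D_def)
        also have "\<dots> \<longleftrightarrow> s \<in> A"
          using squares[OF A sM(1,2)] sM(3) by simp
        finally show ?thesis .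
      qed
      then show ?thesis
        using A by blast
    qed
    then have "inj_on C (Pow S)"
      by (intro inj_on_inverseI[of _ "\<lambda>C. {s \<in> S. t + s \<in> C}"]) auto
    then have "Pow S \<lesssim> sets (borel :: real measure)"
      unfolding lepoll_def using C(1) by (intro exI[of _ C]) auto
    also have "\<dots> \<lesssim> (UNIV :: nat set set)"
      by (rule sets_borel_lepoll)
    also have "\<dots> \<lesssim> (UNIV :: real set)"
      by (rule eqpoll_imp_lepoll[OF nat_sets_eqpoll_reals])
    also have "\<dots> \<lesssim> S"
      by (rule US)
    \<comment> \<open>Distinct Borel sets for all subsets of \<open>S\<close> contradict Cantor's
      theorem, as \<open>S\<close> has as many elements as there are reals.\<close>
    finally have "S \<approx> Pow S"
      by (rule lepoll_antisym[OF lepoll_Pow_self])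
    then show False
      using lesspoll_Pow_self[of S] by (simp add: lesspoll_def)
  qed
  then obtain A where A: "A \<subseteq> S" and nonborel: "D A \<notin> borel_sets_of (order_topology_on (K A))"
    by blast
  have "K A \<approx> (UNIV :: real set)"
    by (rule lepoll_antisym[OF subset_imp_lepoll[OF subset_UNIV]
          lepoll_trans[OF UM subset_imp_lepoll[OF K(2)[OF A]]]])
  then have "K A \<approx> (UNIV :: nat set set)"
    using nat_sets_eqpoll_reals eqpoll_sym eqpoll_trans by blast
  moreover have "has_IP (real_field\<lparr>carrier := K A\<rparr>)"
  proof (rule has_IP_if_pattern_set)
    show "(\<exists>z\<in>K A. z ^ 2 = t + s) \<longleftrightarrow> s \<in> pattern_set" if "s \<in> \<rat>" "s \<ge> 0" for s
      \<comment> \<open>A rational \<open>s\<close> is never in \<open>A\<close>, since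
        \<open>S\<close> omits the rationals.\<close>
      using squares[OF A, of s] that M(2) A by (auto simp: S_def)
  qed (use K[OF A] M(2) in auto)
  moreover have "subfield (K A) real_field"
    by (rule subfield_real_field[OF K(1)[OF A]])
  moreover have "D A \<subseteq> K A"
    by (auto simp: D_def)
  moreover have "empty_definable (real_field\<lparr>carrier := K A\<rparr>) (D A)"
    unfolding D_def by (rule empty_definable_squares)
  ultimately show ?thesis
    using nonborel by blast
qed

end
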